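(* Let $\mathbb{F}$ be a field of characteristic not $2$ or $3$, let $B$ be an invertible symmetric $3\times 3$ matrix over $\mathbb{F}$, and let $\overline{A_0A_1A_2A_3}$ be a (non-coplanar) tetrahedron in $\mathbb{A}^3$ over $\mathbb{F}$ whose four $B$-quadreas $\mathcal{A}_{012},\mathcal{A}_{013},\mathcal{A}_{023},\mathcal{A}_{123}$ are nonzero (so that the $B$-dihedral spreads are defined). Let $\mathcal{V}$ be its $B$-quadrume, $E_{ij}$ ($0\leq i<j\leq 3$) its $B$-dihedral spreads, and $R$ its $B$-circumquadrance. Then $$\left(\mathcal{A}_{012}\mathcal{A}_{013}\mathcal{A}_{023}\mathcal{A}_{123}\right)^2M=1024\,\mathcal{V}^5R,$$ where $$M=-\det\begin{pmatrix}0 & E_{01} & E_{02} & E_{03}\\ E_{01} & 0 & E_{12} & E_{13}\\ E_{02} & E_{12} & 0 & E_{23}\\ E_{03} & E_{13} & E_{23} & 0\end{pmatrix}=A\left(E_{01}E_{23},\,E_{02}E_{13},\,E_{03}E_{12}\right)$$ and $A(a,b,c)=(a+b+c)^2-2(a^2+b^2+c^2)$.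
   Context: $\mathbb{A}^3$ is the three-dimensional affine space over $\mathbb{F}$, with associated vector space $\mathbb{V}^3$ of three-dimensional row vectors over $\mathbb{F}$; for points $X,Y$, $\overrightarrow{XY}=Y-X\in\mathbb{V}^3$. The $B$-scalar product is $u\cdot_B v=uBv^T$, and the $B$-quadratic form is $Q_B(v)=v\cdot_B v$. A tetrahedron $\overline{A_0A_1A_2A_3}$ is a set of four points of $\mathbb{A}^3$, here assumed affinely independent (the vectors $\overrightarrow{A_0A_1},\overrightarrow{A_0A_2},\overrightarrow{A_0A_3}$ are linearly independent). The $B$-quadrances are $Q_{ij}=Q_B(\overrightarrow{A_iA_j})$ for $0\leq i<j\leq 3$. For $0\leq i<j<k\leq 3$, the $B$-quadrea of the triangle $\overline{A_iA_jA_k}$ is $\mathcal{A}_{ijk}=A(Q_{ij},Q_{ik},Q_{jk})$ with $A(a,b,c)=(a+b+c)^2-2(a^2+b^2+c^2)$; it depends only on the set $\{i,j,k\}$, so the order of the indices is irrelevant. The $B$-quadrume is $$\mathcal{V}=\frac12\det\begin{pmatrix}2Q_{01} & Q_{01}+Q_{02}-Q_{12} & Q_{01}+Q_{03}-Q_{13}\\ Q_{01}+Q_{02}-Q_{12} & 2Q_{02} & Q_{02}+Q_{03}-Q_{23}\\ Q_{01}+Q_{03}-Q_{13} & Q_{02}+Q_{03}-Q_{23} & 2Q_{03}\end{pmatrix}.$$ For $0\leq i<j\leq 3$, with $k,l$ the two remaining indices in $\{0,1,2,3\}$, the $B$-dihedral spread between the triangles $\overline{A_iA_jA_k}$ and $\overline{A_iA_jA_l}$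 is $$E_{ij}=\frac{4Q_{ij}\mathcal{V}}{\mathcal{A}_{ijk}\mathcal{A}_{ijl}}.$$ The midpoint $M_{ij}$ of the edge $\overline{A_iA_j}$ is the point with $\overrightarrow{A_iM_{ij}}=\overrightarrow{M_{ij}A_j}=\frac12\overrightarrow{A_iA_j}$. The $B$-midplane of the edge $\overline{A_iA_j}$ is the set of points $X$ with $\overrightarrow{A_iA_j}\cdot_B\overrightarrow{M_{ij}X}=0$. The six $B$-midplanes ($0\leq i<j\leq 3$) have exactly one common point $C$, called the $B$-circumcentre. The $B$-circumquadrance $R$ is the $B$-quadrance between $C$ and any of the points of the tetrahedron, i.e. $R=Q_B(\overrightarrow{A_iC})$, which has the same value for every $i\in\{0,1,2,3\}$. *)

theory Defs
  imports "HOL-Analysis.Analysis"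
begin

text \<open>
  Points and vectors are both row vectors in \<open>'a^3\<close>; the vector from \<open>X\<close> to \<open>Y\<close> is \<open>Y - X\<close>.
  A tetrahedron is a family \<open>P :: 4 \<Rightarrow> 'a^3\<close>; the four elements of the index type \<open>4\<close>
  are \<open>0\<close>, \<open>1\<close>, \<open>2\<close>, \<open>3\<close>.
\<close>

definition dotB :: "'a::field^3^3 \<Rightarrow> 'a^3 \<Rightarrow> 'a^3 \<Rightarrow> 'a" where
  "dotB B u v = (\<Sum>i\<in>UNIV. (u v* B) $ i * v $ i)"

definition quadB :: "'a::field^3^3 \<Rightarrow> 'a^3 \<Rightarrow> 'a" where
  "quadB B v = dotB B v v"

definition quadrance :: "'a::field^3^3 \<Rightarrow> 'a^3 \<Rightarrow> 'a^3 \<Rightarrow> 'a" where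
  "quadrance B X Y = quadB B (Y - X)"

definition archimedes :: "'a::field \<Rightarrow> 'a \<Rightarrow> 'a \<Rightarrow> 'a" where
  "archimedes a b c = (a + b + c)^2 - 2 * (a^2 + b^2 + c^2)"

definition quadrea :: "'a::field^3^3 \<Rightarrow> 'a^3 \<Rightarrow> 'a^3 \<Rightarrow> 'a^3 \<Rightarrow> 'a" where
  "quadrea B X Y Z = archimedes (quadrance B X Y) (quadrance B X Z) (quadrance B Y Z)"

text \<open>
  The injectivity condition is needed because \<open>vec.independent\<close> speaks about a set, in which
  coinciding vectors would collapse.
\<close>

definition noncoplanar :: "(4 \<Rightarrow> 'a::field^3) \<Rightarrow> bool" where
  "noncoplanar P \<longleftrightarrow>
     inj_on (\<lambda>k. P k - P 0) {1, 2, 3} \<and> vec.independent ((\<lambda>k. P k - P 0) ` {1, 2, 3})"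

definition quadrume :: "'a::field^3^3 \<Rightarrow> (4 \<Rightarrow> 'a^3) \<Rightarrow> 'a" where
  "quadrume B P =
     (let Q = (\<lambda>i j. quadrance B (P i) (P j)) in
      1 / 2 * det (vector
        [vector [2 * Q 0 1, Q 0 1 + Q 0 2 - Q 1 2, Q 0 1 + Q 0 3 - Q 1 3],
         vector [Q 0 1 + Q 0 2 - Q 1 2, 2 * Q 0 2, Q 0 2 + Q 0 3 - Q 2 3],
         vector [Q 0 1 + Q 0 3 - Q 1 3, Q 0 2 + Q 0 3 - Q 2 3, 2 * Q 0 3]] :: 'a^3^3))"

text \<open>
  For \<open>i \<noteq> j\<close> the product has exactly two factors, one for each of the two remaining indices.
\<close>

definition dihedral_spread :: "'a::field^3^3 \<Rightarrow> (4 \<Rightarrow> 'a^3) \<Rightarrow> 4 \<Rightarrow> 4 \<Rightarrow> 'a" where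
  "dihedral_spread B P i j =
     4 * quadrance B (P i) (P j) * quadrume B P /
     (\<Prod>k\<in>UNIV - {i, j}. quadrea B (P i) (P j) (P k))"

definition edge_midpoint :: "'a::field^3 \<Rightarrow> 'a^3 \<Rightarrow> 'a^3" where
  "edge_midpoint X Y = X + (1 / 2) *s (Y - X)"

definition midplane :: "'a::field^3^3 \<Rightarrow> 'a^3 \<Rightarrow> 'a^3 \<Rightarrow> ('a^3) set" where
  "midplane B X Y = {Z. dotB B (Y - X) (Z - edge_midpoint X Y) = 0}"

definition circumcentre :: "'a::field^3^3 \<Rightarrow> (4 \<Rightarrow> 'a^3) \<Rightarrow> 'a^3" where
  "circumcentre B P = (THE C. \<forall>i j. i \<noteq> j \<longrightarrow> C \<in> midplane B (P i) (P j))"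

text \<open>The common value of the quadrances from the vertices to the circumcentre.\<close>

definition circumquadrance :: "'a::field^3^3 \<Rightarrow> (4 \<Rightarrow> 'a^3) \<Rightarrow> 'a" where
  "circumquadrance B P = (THE r. \<forall>i. quadrance B (P i) (circumcentre B P) = r)"

end

theory Submission
  imports Defs
begin

text \<open>
  Every edge quadrance \<open>Q\<^sub>i\<^sub>j\<close> is divided in \<open>E\<^sub>i\<^sub>j\<close> by the quadreas of the two faces that contain the
  edge. Each of the four faces contains exactly one of two opposite edges \<open>ij\<close> and \<open>kl\<close>, so the
  products \<open>E\<^sub>i\<^sub>j E\<^sub>k\<^sub>l\<close> are the products \<open>Q\<^sub>i\<^sub>j Q\<^sub>k\<^sub>l\<close> multiplied by one common factor
  \<open>t = 16 V\<^sup>2 / p\<close>, where \<open>p\<close> is the product of the four quadreas. The determinant of a symmetric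
  \<open>4 \<times> 4\<close> matrix with zero diagonal depends only on the three products of complementary
  entries, through the quadratic form \<open>archimedes\<close> (\<open>det_hollow_symmetric_4\<close>). Hence \<open>M\<close> is
  \<open>t\<^sup>2\<close> times the same expression in the quadrances, and the theorem reduces to Crelle's formula

    \<open>archimedes (Q\<^sub>0\<^sub>1 Q\<^sub>2\<^sub>3) (Q\<^sub>0\<^sub>2 Q\<^sub>1\<^sub>3) (Q\<^sub>0\<^sub>3 Q\<^sub>1\<^sub>2) = 4 V R\<close>   (lemma \<open>crelle\<close>),

  the analogue of the classical statement that the triangle whose sides are the products of opposite
  edges of a tetrahedron has area six times the volume times the circumradius.

  For Crelle's formula, take \<open>P 0\<close> as origin and let \<open>G\<close> be the Gram matrix of the three edge
  vectors \<open>v\<^sub>k\<close> from it. With the circumcentre at \<open>w = \<Sum> x\<^sub>k v\<^sub>k\<close>, the midplanes of the edges at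
  \<open>P 0\<close> say \<open>2 G x = q\<close>, where \<open>q\<close> is the diagonal of \<open>G\<close>; moreover \<open>2 R = q \<cdot> x\<close> and
  \<open>V = 4 det G\<close>. Multiplying \<open>q \<cdot> x\<close> by \<open>det G\<close> turns it into a multiple of \<open>q \<cdot> adj(G) q\<close>
  (\<open>quadratic_form_inverse_cramer\<close>), which expands to a multiple of the left-hand side.
\<close>

section \<open>Indices, determinants and the form of Archimedes\<close>

lemma two_neq_zero_if_CHAR_neq_2:
  assumes "CHAR('a::field) \<noteq> 2"
  shows "(2::'a) \<noteq> 0"
proof
  assume "(2::'a) = 0"
  then have "of_nat 2 = (0::'a)" by simp
  then have "CHAR('a) dvd 2" by (simp only: of_nat_eq_0_iff_char_dvd)
  then have "CHAR('a) = 1 \<or> CHAR('a) = 2" using primes_dvd_imp_eq two_is_prime_nat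
    by (auto simp: prime_nat_iff)
  then show False using assms CHAR_not_1 by auto
qed

text \<open>
  In the index type \<open>4\<close> the numeral \<open>4\<close> is \<open>0\<close>: vertices are numbered from \<open>0\<close> to \<open>3\<close>, whereas the
  entries of \<open>vector [\<dots>]\<close> and the expansions of sums and determinants are numbered from \<open>1\<close> to \<open>4\<close>.
\<close>

lemma forall_4_from_0: "(\<forall>i::4. p i) \<longleftrightarrow> p 0 \<and> p 1 \<and> p 2 \<and> p 3"
proof -
  have "(4::4) = 0" by simp
  then show ?thesis unfolding forall_4 by metis
qed

lemma vector_4 [simp]:
  "(vector [w, x, y, z] :: 'a::zero^4) $ 1 = w"
  "(vector [w, x, y, z] :: 'a::zero^4) $ 2 = x"
  "(vector [w, x, y, z] :: 'a::zero^4) $ 3 = y"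
  "(vector [w, x, y, z] :: 'a::zero^4) $ 4 = z"
  "(vector [w, x, y, z] :: 'a::zero^4) $ 0 = z"
  unfolding vector_def by simp_all

lemma det_4:
  fixes A :: "'a::comm_ring_1^4^4"
  shows "det A =
    A$1$1 * A$2$2 * A$3$3 * A$4$4 - A$1$1 * A$2$2 * A$3$4 * A$4$3
  - A$1$1 * A$2$3 * A$3$2 * A$4$4 + A$1$1 * A$2$3 * A$3$4 * A$4$2
  + A$1$1 * A$2$4 * A$3$2 * A$4$3 - A$1$1 * A$2$4 * A$3$3 * A$4$2
  - A$1$2 * A$2$1 * A$3$3 * A$4$4 + A$1$2 * A$2$1 * A$3$4 * A$4$3
  + A$1$2 * A$2$3 * A$3$1 * A$4$4 - A$1$2 * A$2$3 * A$3$4 * A$4$1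
  - A$1$2 * A$2$4 * A$3$1 * A$4$3 + A$1$2 * A$2$4 * A$3$3 * A$4$1
  + A$1$3 * A$2$1 * A$3$2 * A$4$4 - A$1$3 * A$2$1 * A$3$4 * A$4$2
  - A$1$3 * A$2$2 * A$3$1 * A$4$4 + A$1$3 * A$2$2 * A$3$4 * A$4$1
  + A$1$3 * A$2$4 * A$3$1 * A$4$2 - A$1$3 * A$2$4 * A$3$2 * A$4$1
  - A$1$4 * A$2$1 * A$3$2 * A$4$3 + A$1$4 * A$2$1 * A$3$3 * A$4$2
  + A$1$4 * A$2$2 * A$3$1 * A$4$3 - A$1$4 * A$2$2 * A$3$3 * A$4$1
  - A$1$4 * A$2$3 * A$3$1 * A$4$2 + A$1$4 * A$2$3 * A$3$2 * A$4$1"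
proof -
  have f1234: "finite {2::4, 3, 4}" "1 \<notin> {2::4, 3, 4}" by auto
  have f234: "finite {3::4, 4}" "2 \<notin> {3::4, 4}" by auto
  have f34: "finite {4::4}" "3 \<notin> {4::4}" by auto
  show ?thesis
    unfolding det_def UNIV_4
    unfolding sum_over_permutations_insert[OF f1234]
    unfolding sum_over_permutations_insert[OF f234]
    unfolding sum_over_permutations_insert[OF f34]
    unfolding permutes_sing
    by (simp add: sign_swap_id sign_compose permutation_swap_id permutation_compose)
qed

text \<open>
  Only the nine permutations without fixed points survive. The three double transpositions give the
  squares of the products of complementary entries; the six 4-cycles give, in mutually inverse
  pairs, the mixed terms.
\<close>

lemma det_hollow_symmetric_4:
  fixes a b c d e f :: "'a::field"
  shows "- det (vector [vector [0, a, b, c], vector [a, 0, d, e],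
            vector [b, d, 0, f], vector [c, e, f, 0]] :: 'a^4^4)
          = archimedes (a * f) (b * e) (c * d)"
  unfolding det_4 archimedes_def by (simp add: algebra_simps power2_eq_square)

lemma archimedes_scale: "archimedes (t * a) (t * b) (t * c) = t^2 * archimedes a b c"
  unfolding archimedes_def by algebra

lemma archimedes_commute_12: "archimedes a b c = archimedes b a c"
  and archimedes_commute_23: "archimedes a b c = archimedes a c b"
  unfolding archimedes_def by algebra+

section \<open>The scalar product and the midplanes\<close>

lemma dotB_add_left: "dotB B (u + u') v = dotB B u v + dotB B u' v"
  and dotB_scale_left: "dotB B (c *s u) v = c * dotB B u v"
  and dotB_add_right: "dotB B u (v + v') = dotB B u v + dotB B u v'"
  and dotB_scale_right: "dotB B u (c *s v) = c * dotB B u v"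
  and dotB_diff_left: "dotB B (u - u') v = dotB B u v - dotB B u' v"
  and dotB_diff_right: "dotB B u (v - v') = dotB B u v - dotB B u v'"
  unfolding dotB_def vector_matrix_mult_def
  by (simp_all add: sum.distrib sum_subtractf sum_distrib_left algebra_simps)

lemmas dotB_linear = dotB_add_left dotB_scale_left dotB_add_right dotB_scale_right
  dotB_diff_left dotB_diff_right

lemma dotB_zero_left: "dotB B 0 v = 0"
  unfolding dotB_def by simp

lemma dotB_commute:
  assumes "transpose B = B"
  shows "dotB B u v = dotB B v u"
proof -
  have sym: "B $ i $ j = B $ j $ i" for i j
  proof -
    have "transpose B $ i $ j = B $ j $ i" by (simp add: transpose_def)
    then show ?thesis using assms by simp
  qed
  have "dotB B u v = (\<Sum>i\<in>UNIV. \<Sum>j\<in>UNIV. u $ j * B $ j $ i * v $ i)"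
    unfolding dotB_def vector_matrix_mult_def by (simp add: sum_distrib_right)
  also have "\<dots> = (\<Sum>j\<in>UNIV. \<Sum>i\<in>UNIV. u $ j * B $ j $ i * v $ i)"
    by (rule sum.swap)
  also have "\<dots> = (\<Sum>j\<in>UNIV. \<Sum>i\<in>UNIV. v $ i * B $ i $ j * u $ j)"
    by (intro sum.cong refl) (subst sym, simp add: mult_ac)
  also have "\<dots> = dotB B v u"
    unfolding dotB_def vector_matrix_mult_def by (simp add: sum_distrib_right)
  finally show ?thesis .
qed

lemma quadB_diff:
  assumes "transpose B = B"
  shows "quadB B (u - v) = quadB B u + quadB B v - 2 * dotB B u v"
  unfolding quadB_def using dotB_commute[OF assms, of u v] by (simp add: dotB_linear)

lemma quadrance_commute: "quadrance B X Y = quadrance B Y X"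
  unfolding quadrance_def quadB_def by (simp add: dotB_diff_left dotB_diff_right)

text \<open>
  The polarisation identity: it lets all six quadrances of a tetrahedron be written in terms of the
  Gram matrix of the edge vectors at one vertex \<open>A\<close>.
\<close>

lemma quadrance_from_origin:
  assumes "transpose B = B"
  shows "quadrance B X Y = quadB B (X - A) + quadB B (Y - A) - 2 * dotB B (X - A) (Y - A)"
  using quadB_diff[OF assms, of "Y - A" "X - A"] dotB_commute[OF assms, of "X - A" "Y - A"]
  unfolding quadrance_def by simp

lemma quadrea_commute_12: "quadrea B X Y Z = quadrea B Y X Z"
  unfolding quadrea_def quadrance_commute[of B Y X] by (rule archimedes_commute_23)

lemma quadrea_commute_23: "quadrea B X Y Z = quadrea B X Z Y"
  unfolding quadrea_def quadrance_commute[of B Z Y] by (rule archimedes_commute_12)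

text \<open>
  Midplanes are loci of equal quadrance, as for perpendicular bisectors. In this form the six midplane
  conditions are visibly consequences of the three that compare each vertex with \<open>P 0\<close>.
\<close>

lemma mem_midplane_iff_quadrance_eq:
  fixes B :: "'a::field^3^3"
  assumes "(2::'a) \<noteq> 0" "transpose B = B"
  shows "Z \<in> midplane B X Y \<longleftrightarrow> quadrance B X Z = quadrance B Y Z"
proof -
  define d where "d = dotB B (Y - X) (Z - X)"
  have mid: "Z - edge_midpoint X Y = (Z - X) - (1/2) *s (Y - X)"
    unfolding edge_midpoint_def by simp
  have "dotB B (Y - X) (Z - edge_midpoint X Y) = d - quadrance B X Y / 2"
    unfolding mid quadrance_def quadB_def d_def by (simp only: dotB_linear) simp
  moreover have "quadrance B Y Z = quadrance B X Y + quadrance B X Z - 2 * d"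
    using quadrance_from_origin[OF assms(2), of Y Z X] unfolding quadrance_def d_def by simp
  ultimately show ?thesis
    unfolding midplane_def using assms(1) by (auto simp: field_simps)
qed

section \<open>The circumcentre\<close>

lemma invertible_if_noncoplanar:
  fixes P :: "4 \<Rightarrow> 'a::field^3"
  assumes "noncoplanar P"
  shows "invertible (vector [P 1 - P 0, P 2 - P 0, P 3 - P 0] :: 'a^3^3)" (is "invertible ?N")
proof -
  have "c 1 = 0 \<and> c 2 = 0 \<and> c 3 = 0" if sum0: "(\<Sum>i\<in>UNIV. c i *s row i ?N) = 0" for c :: "3 \<Rightarrow> 'a"
  proof -
    let ?v = "\<lambda>k. P k - P 0"
    have ne: "?v 1 \<noteq> ?v 2" "?v 1 \<noteq> ?v 3" "?v 2 \<noteq> ?v 3"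
      and ind: "vec.independent {?v 1, ?v 2, ?v 3}"
      using assms unfolding noncoplanar_def by auto
    define u where "u x = (if x = ?v 1 then c 1 else if x = ?v 2 then c 2 else c 3)" for x
    have "(\<Sum>x\<in>{?v 1, ?v 2, ?v 3}. u x *s x) = 0"
      using sum0 ne by (simp add: sum_3 row_def vec_nth_inverse u_def add.assoc)
    then have "u x = 0" if "x \<in> {?v 1, ?v 2, ?v 3}" for x
      using vec.independentD[OF ind _ subset_refl] that by blast
    from this[of "?v 1"] this[of "?v 2"] this[of "?v 3"] show ?thesis
      using ne by (simp add: u_def)
  qed
  then show ?thesis
    unfolding invertible_right_inverse matrix_right_invertible_independent_rows forall_3 by blast
qed

text \<open>
  The conditions are the linear system with matrix \<open>N B\<close>, where \<open>N\<close> has the rows \<open>u\<close>, \<open>v\<close>, \<open>w\<close>; this is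
  where non-degeneracy of \<open>B\<close> gives existence and uniqueness of the circumcentre.
\<close>

lemma ex1_dotB_eq_on_basis:
  fixes B :: "'a::field^3^3"
  assumes "invertible B" and "invertible (vector [u, v, w] :: 'a^3^3)"
  shows "\<exists>!x. dotB B u x = a \<and> dotB B v x = b \<and> dotB B w x = c"
proof -
  let ?N = "vector [u, v, w] :: 'a^3^3"
  let ?r = "vector [a, b, c] :: 'a^3"
  have "dotB B (?N $ k) x = ((?N ** B) *v x) $ k" for x k
    unfolding dotB_def matrix_vector_mult_def matrix_matrix_mult_def vector_matrix_mult_def
    by (simp add: mult.commute)
  from this[of 1] this[of 2] this[of 3]
  have eq: "dotB B u x = a \<and> dotB B v x = b \<and> dotB B w x = c \<longleftrightarrow> (?N ** B) *v x = ?r" for x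
    by (simp add: vec_eq_iff forall_3)
  have "invertible (?N ** B)" using assms by (intro invertible_mult)
  then obtain N' where N': "(?N ** B) ** N' = mat 1" "N' ** (?N ** B) = mat 1"
    unfolding invertible_def by blast
  show ?thesis unfolding eq
  proof (rule ex1I)
    show "(?N ** B) *v (N' *v ?r) = ?r"
      by (simp only: matrix_vector_mul_assoc N' matrix_vector_mul_lid)
    show "x = N' *v ?r" if "(?N ** B) *v x = ?r" for x
      unfolding that[symmetric] by (simp only: matrix_vector_mul_assoc N' matrix_vector_mul_lid)
  qed
qed

lemma coordinates_in_basis:
  fixes x :: "'a::field^3"
  assumes "invertible (vector [u, v, w] :: 'a^3^3)"
  obtains a b c where "x = a *s u + b *s v + c *s w"
proof -
  let ?N = "vector [u, v, w] :: 'a^3^3"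
  obtain N' where "N' ** ?N = mat 1" using assms unfolding invertible_def by blast
  then have "x = (x v* N') v* ?N" by (simp add: vector_matrix_mul_assoc)
  then have "x = (x v* N') $ 1 *s u + (x v* N') $ 2 *s v + (x v* N') $ 3 *s w"
    unfolding vec_eq_iff vector_matrix_mult_def[of _ ?N] by (simp add: sum_3 mult.commute)
  then show thesis by (rule that)
qed

text \<open>
  This replaces the definite descriptions in \<open>circumcentre\<close> and \<open>circumquadrance\<close> by equations. For
  \<open>k = 0\<close> the first equation is trivial; the other three determine the circumcentre.
\<close>

lemma circumcentre_circumquadrance:
  fixes B :: "'a::field^3^3" and P :: "4 \<Rightarrow> 'a^3"
  assumes two: "(2::'a) \<noteq> 0" and B: "invertible B" "transpose B = B" and P: "noncoplanar P"
  shows "2 * dotB B (P k - P 0) (circumcentre B P - P 0) = quadB B (P k - P 0)"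
    and "circumquadrance B P = quadB B (circumcentre B P - P 0)"
proof -
  have quadrance_eq_iff: "quadrance B (P k) C = quadrance B (P 0) C
      \<longleftrightarrow> dotB B (P k - P 0) (C - P 0) = quadB B (P k - P 0) / 2" for C k
    using quadrance_from_origin[OF B(2), of "P k" C "P 0"] two
    unfolding quadrance_def by (auto simp: field_simps)
  have midplanes_iff: "(\<forall>i j. i \<noteq> j \<longrightarrow> C \<in> midplane B (P i) (P j))
      \<longleftrightarrow> (\<forall>k. dotB B (P k - P 0) (C - P 0) = quadB B (P k - P 0) / 2)" for C
    unfolding mem_midplane_iff_quadrance_eq[OF two B(2)] quadrance_eq_iff[symmetric] by metis
  have "\<exists>!C. \<forall>k. dotB B (P k - P 0) (C - P 0) = quadB B (P k - P 0) / 2"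
  proof -
    obtain x where x: "\<And>y. dotB B (P 1 - P 0) y = quadB B (P 1 - P 0) / 2
        \<and> dotB B (P 2 - P 0) y = quadB B (P 2 - P 0) / 2
        \<and> dotB B (P 3 - P 0) y = quadB B (P 3 - P 0) / 2 \<longleftrightarrow> y = x"
      using ex1_dotB_eq_on_basis[OF B(1) invertible_if_noncoplanar[OF P]] by metis
    have "(\<forall>k. dotB B (P k - P 0) (C - P 0) = quadB B (P k - P 0) / 2) \<longleftrightarrow> C = x + P 0" for C
      unfolding forall_4_from_0 using x[of "C - P 0"] by (simp add: dotB_zero_left quadB_def diff_eq_eq)
    then show ?thesis by simp
  qed
  from theI'[OF this]
  have centre: "dotB B (P k - P 0) (circumcentre B P - P 0) = quadB B (P k - P 0) / 2" for k
    unfolding circumcentre_def midplanes_iff by blast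
  then show "2 * dotB B (P k - P 0) (circumcentre B P - P 0) = quadB B (P k - P 0)"
    using two by (simp add: mult.commute)
  have "quadrance B (P k) (circumcentre B P) = quadrance B (P 0) (circumcentre B P)" for k
    using centre quadrance_eq_iff by blast
  then have "circumquadrance B P = quadrance B (P 0) (circumcentre B P)"
    unfolding circumquadrance_def by (intro the_equality) auto
  then show "circumquadrance B P = quadB B (circumcentre B P - P 0)"
    by (simp add: quadrance_def)
qed

section \<open>Crelle's formula\<close>

text \<open>
  Cramer's rule without division: if \<open>2 G x = q\<close> for the symmetric matrix \<open>G\<close> with diagonal
  \<open>a, b, c\<close> and off-diagonal entries \<open>d, e, f\<close>, then \<open>2 det G (q \<cdot> x) = q \<cdot> adj(G) q\<close>. The right-hand
  side \<open>q\<close> is kept general because the proof substitutes it away; for \<open>q = (a, b, c)\<close>, the case of a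
  circumcentre, such a substitution would be circular.
\<close>

lemma quadratic_form_inverse_cramer:
  fixes a b c d e f x y z p q r :: "'a::field"
  assumes "2 * (a * x + d * y + e * z) = p"
    and "2 * (d * x + b * y + f * z) = q"
    and "2 * (e * x + f * y + c * z) = r"
  shows "2 * (a * b * c + 2 * d * e * f - a * f^2 - b * e^2 - c * d^2) * (p * x + q * y + r * z)
    = (b * c - f^2) * p^2 + (a * c - e^2) * q^2 + (a * b - d^2) * r^2
      + 2 * (e * f - c * d) * p * q + 2 * (d * f - b * e) * p * r + 2 * (d * e - a * f) * q * r"
  unfolding assms[symmetric] by algebra


text \<open>
  Both sides are \<open>4 q \<cdot> adj(G) q\<close> for the Gram matrix \<open>G\<close> of the edge vectors at \<open>P 0\<close> and its diagonal
  \<open>q\<close>: the right-hand side by Cramer's rule applied to the coordinates of the circumcentre, the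
  left-hand side by direct expansion.
\<close>

lemma crelle:
  fixes B :: "'a::field^3^3" and P :: "4 \<Rightarrow> 'a^3"
  assumes two: "(2::'a) \<noteq> 0" and B: "invertible B" "transpose B = B" and P: "noncoplanar P"
  defines "Q \<equiv> \<lambda>i j. quadrance B (P i) (P j)"
  shows "archimedes (Q 0 1 * Q 2 3) (Q 0 2 * Q 1 3) (Q 0 3 * Q 1 2)
    = 4 * quadrume B P * circumquadrance B P"
proof -
  define v where "v k = P k - P 0" for k
  define w where "w = circumcentre B P - P 0"
  define a b c d e f where g: "a = quadB B (v 1)" "b = quadB B (v 2)" "c = quadB B (v 3)"
    "d = dotB B (v 1) (v 2)" "e = dotB B (v 1) (v 3)" "f = dotB B (v 2) (v 3)"
  define D where "D = a * b * c + 2 * d * e * f - a * f^2 - b * e^2 - c * d^2"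
  have Q: "Q 0 1 = a" "Q 0 2 = b" "Q 0 3 = c"
    "Q 1 2 = a + b - 2 * d" "Q 1 3 = a + c - 2 * e" "Q 2 3 = b + c - 2 * f"
    unfolding Q_def g v_def quadrance_from_origin[OF B(2), of "P _" "P _" "P 0"]
    by (simp_all add: quadB_def dotB_zero_left)
  obtain x y z where w_eq: "w = x *s v 1 + y *s v 2 + z *s v 3"
    using coordinates_in_basis[OF invertible_if_noncoplanar[OF P]] unfolding v_def by metis
  have vw: "2 * dotB B (v k) w = quadB B (v k)" for k
    unfolding v_def w_def by (rule circumcentre_circumquadrance(1)[OF two B P])
  have "2 * (a * x + d * y + e * z) = a" "2 * (d * x + b * y + f * z) = b"
    "2 * (e * x + f * y + c * z) = c"
    using vw[of 1] vw[of 2] vw[of 3] dotB_commute[OF B(2)]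
    unfolding w_eq g quadB_def by (simp_all add: dotB_linear algebra_simps)
  from quadratic_form_inverse_cramer[OF this]
  have adj: "2 * D * (a * x + b * y + c * z)
    = (b * c - f^2) * a^2 + (a * c - e^2) * b^2 + (a * b - d^2) * c^2
      + 2 * (e * f - c * d) * a * b + 2 * (d * f - b * e) * a * c + 2 * (d * e - a * f) * b * c"
    unfolding D_def .
  have "quadB B w = x * dotB B (v 1) w + y * dotB B (v 2) w + z * dotB B (v 3) w"
    unfolding quadB_def by (subst (1) w_eq) (simp only: dotB_linear)
  then have "2 * quadB B w = x * (2 * dotB B (v 1) w) + y * (2 * dotB B (v 2) w) + z * (2 * dotB B (v 3) w)"
    by (simp add: algebra_simps)
  then have R: "2 * circumquadrance B P = a * x + b * y + c * z"
    unfolding circumcentre_circumquadrance(2)[OF two B P] vw g w_def[symmetric]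
    by (simp add: mult.commute)
  \<comment> \<open>By polarisation the matrix in \<open>quadrume\<close> is \<open>2 G\<close>, with determinant \<open>8 D\<close>.\<close>
  have "quadrume B P = 1 / 2 * (2 * (4 * D))"
    unfolding quadrume_def Let_def Q[unfolded Q_def] det_3 D_def vector_3
    by (rule arg_cong[where f = "(*) (1 / 2)"]) algebra
  also have "\<dots> = 1 / 2 * 2 * (4 * D)" by (simp only: mult.assoc)
  also have "1 / 2 * 2 = (1::'a)" using two by simp
  finally have V: "quadrume B P = 4 * D" by simp
  have "archimedes (Q 0 1 * Q 2 3) (Q 0 2 * Q 1 3) (Q 0 3 * Q 1 2)
    = 4 * (2 * D * (a * x + b * y + c * z))"
    unfolding adj Q archimedes_def by algebra
  then show ?thesis unfolding R[symmetric] V by (simp add: mult_ac)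
qed

section \<open>Dihedral spreads\<close>

lemma dihedral_spread_eq:
  assumes "i \<noteq> j" "k \<noteq> l" "k \<notin> {i, j}" "l \<notin> {i, j}"
  shows "dihedral_spread B P i j = 4 * quadrance B (P i) (P j) * quadrume B P /
    (quadrea B (P i) (P j) (P k) * quadrea B (P i) (P j) (P l))"
proof -
  have "card {i, j, k, l} = CARD(4)" using assms by auto
  then have "{i, j, k, l} = UNIV" by (intro card_eq_UNIV_imp_eq_UNIV) auto
  then have "UNIV - {i, j} = {k, l}" using assms by blast
  then show ?thesis unfolding dihedral_spread_def using assms(2) by simp
qed

theorem theorem4:
  fixes B :: "'a::field^3^3" and P :: "4 \<Rightarrow> 'a^3"
    and A :: "4 \<Rightarrow> 4 \<Rightarrow> 4 \<Rightarrow> 'a" and E :: "4 \<Rightarrow> 4 \<Rightarrow> 'a" and V R M :: 'a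
  assumes char: "CHAR('a) \<noteq> 2" "CHAR('a) \<noteq> 3"
    and B: "invertible B" "transpose B = B"
    and P: "noncoplanar P"
    and A: "A = (\<lambda>i j k. quadrea B (P i) (P j) (P k))"
    and nonzero: "A 0 1 2 \<noteq> 0" "A 0 1 3 \<noteq> 0" "A 0 2 3 \<noteq> 0" "A 1 2 3 \<noteq> 0"
    and V: "V = quadrume B P"
    and E: "E = dihedral_spread B P"
    and R: "R = circumquadrance B P"
    and M: "M = - det (vector
        [vector [0, E 0 1, E 0 2, E 0 3],
         vector [E 0 1, 0, E 1 2, E 1 3],
         vector [E 0 2, E 1 2, 0, E 2 3],
         vector [E 0 3, E 1 3, E 2 3, 0]] :: 'a^4^4)"
  shows "(A 0 1 2 * A 0 1 3 * A 0 2 3 * A 1 2 3)^2 * M = 1024 * V^5 * R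
    \<and> M = archimedes (E 0 1 * E 2 3) (E 0 2 * E 1 3) (E 0 3 * E 1 2)"
proof -
  have two: "(2::'a) \<noteq> 0" using char(1) by (rule two_neq_zero_if_CHAR_neq_2)
  define Q where "Q i j = quadrance B (P i) (P j)" for i j
  define p where "p = A 0 1 2 * A 0 1 3 * A 0 2 3 * A 1 2 3"
  define t where "t = 16 * V^2 / p"
  have perm: "A j i k = A i j k" "A i k j = A i j k" for i j k
    unfolding A by (rule quadrea_commute_12 quadrea_commute_23)+
  have E_eq: "E i j = 4 * Q i j * V / (A i j k * A i j l)"
    if "i \<noteq> j" "k \<noteq> l" "k \<notin> {i, j}" "l \<notin> {i, j}" for i j k l
    unfolding E Q_def V A using that by (rule dihedral_spread_eq)
  have sorted: "A 0 2 1 = A 0 1 2" "A 1 2 0 = A 0 1 2" "A 0 3 1 = A 0 1 3" "A 1 3 0 = A 0 1 3"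
    "A 0 3 2 = A 0 2 3" "A 2 3 0 = A 0 2 3" "A 1 3 2 = A 1 2 3" "A 2 3 1 = A 1 2 3"
    using perm by metis+
  have "E 0 1 = 4 * Q 0 1 * V / (A 0 1 2 * A 0 1 3)" "E 2 3 = 4 * Q 2 3 * V / (A 0 2 3 * A 1 2 3)"
    "E 0 2 = 4 * Q 0 2 * V / (A 0 1 2 * A 0 2 3)" "E 1 3 = 4 * Q 1 3 * V / (A 0 1 3 * A 1 2 3)"
    "E 0 3 = 4 * Q 0 3 * V / (A 0 1 3 * A 0 2 3)" "E 1 2 = 4 * Q 1 2 * V / (A 0 1 2 * A 1 2 3)"
    using E_eq[of 0 1 2 3] E_eq[of 2 3 0 1] E_eq[of 0 2 1 3] E_eq[of 1 3 0 2]
      E_eq[of 0 3 1 2] E_eq[of 1 2 0 3] by (simp_all add: sorted)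
  \<comment> \<open>The two faces at an edge and the two faces at the opposite edge make up all four, so the
    two denominators multiply to \<open>p\<close> in each case.\<close>
  then have EE: "E 0 1 * E 2 3 = t * (Q 0 1 * Q 2 3)"
    "E 0 2 * E 1 3 = t * (Q 0 2 * Q 1 3)" "E 0 3 * E 1 2 = t * (Q 0 3 * Q 1 2)"
    unfolding t_def p_def by (simp_all add: power2_eq_square mult_ac)
  have M_eq: "M = archimedes (E 0 1 * E 2 3) (E 0 2 * E 1 3) (E 0 3 * E 1 2)"
    unfolding M by (rule det_hollow_symmetric_4)
  also have "\<dots> = t^2 * (4 * V * R)"
    unfolding EE archimedes_scale Q_def V R crelle[OF two B P] ..
  finally have "p^2 * M = (t * p)^2 * (4 * V * R)" by algebra
  also have "t * p = 16 * V^2" using nonzero unfolding t_def p_def by simp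
  finally have "p^2 * M = 1024 * V^5 * R" by algebra
  then show ?thesis using M_eq unfolding p_def by simp
qed

end
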